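(* For every finite word $w$ on $\{\mathsf L,\mathsf R\}$, the polynomial triples $(R_w^+,R_w^-,R_w)$ and $(J_w^+,J_w^-,J_w)$ in $\mathbb Z_{\ge0}[t]$ are equal, where in the second triple $w$ is read as a word on $\{\mathsf U,\mathsf D\}$ via $\mathsf L\leftrightarrow\mathsf U$, $\mathsf R\leftrightarrow\mathsf D$. Moreover, $R_w^+(t)$ is coprime to $R_w^-(t)$ for all $w$, and the rational functions $\overline R_w(t)=R_w^+(t)/R_w^-(t)$, $w\in\{\mathsf L,\mathsf R\}^*$, form the unique family of rational functions $f_w=p_w/q_w$ satisfying $f_\varepsilon(t)=t/1$ (where $\varepsilon$ is the empty word) and the successor rules: if $f_w=\dfrac{p}{q}$ then $$f_{w\mathsf L}=\frac{tp}{p+q},\qquad f_{w\mathsf R}=\frac{t(p+q)}{q}.$$ Specializing at $t=1$ gives the classical Calkin–Wilf rules ($\tfrac ab\mapsto\tfrac{a}{a+b}$ for $\mathsf L$ and $\tfrac ab\mapsto\tfrac{a+b}{b}$ for $\mathsf R$, starting from $\tfrac11$), with $f_w(1)=a/b$ for coprime positive integers $a,b$ if and only if $\mathfrak p_w=\mathfrak p(a,b)$.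
   Context: For coprime positive integers $a,b$ and $n=a+b$, $\mathfrak p(a,b)$ is the Frobenius maximal parabolic subalgebra of $\mathfrak{sl}_n$ consisting of trace-zero matrices $X$ with $X_{i,j}=0$ for $i>a$, $j\le a$. Addresses. Each pair $(a,b)$ of coprime positive integers has a unique address, a finite word $w$ on $\{\mathsf L,\mathsf R\}$: $\mathfrak p_\varepsilon=\mathfrak p(1,1)$, and if $\mathfrak p_w=\mathfrak p(a,b)$ then $\mathfrak p_{w\mathsf L}=\mathfrak p(a,a+b)$ and $\mathfrak p_{w\mathsf R}=\mathfrak p(a+b,b)$. Ranked meander. The meander $M_{a,b}$ of $\mathfrak p(a,b)$ is the directed graph on $\{1,\dots,n\}$ with edges $i\to n+1-i$ for $1\le i<n+1-i$; edges $a+1-i\to i$ for $1\le i<a+1-i$; and edges $n+1-i\to a+i$ for $i\ge1$ with $a+i<n+1-i$. Since $\gcd(a,b)=1$, its underlying undirected graph is a single path. Its rank function $\operatorname{rnk}$ is the unique integer-valued function on the vertices with minimum value $0$ and $\operatorname{rnk}(k)=\operatorname{rnk}(\ell)+1$ for each edge $k\to\ell$. If $\mathfrak p_w=\mathfrak p(a,b)$, set $$R_w^+(t)=\sum_{i=1}^a t^{\operatorname{rnk}(i)},\quad R_w^-(t)=\sum_{i=a+1}^n t^{\operatorname{rnk}(i)},\quad R_w(t)=R_w^+(t)+R_w^-(t).$$ Fence posets. For a finite word $w=w_1\cdots w_l$ on $\{\mathsf U,\mathsf D\}$, the fence poset $P_w$ is the poset on $\{1,\dots,l+1\}$ generated by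 the relations $k<k+1$ if $w_k=\mathsf U$ and $k>k+1$ if $w_k=\mathsf D$. Let $\mathcal J_w$ be the set of order ideals (downward closed subsets) of $P_w$, with $\operatorname{rnk}(I)=|I|$. Put $$J_w(t)=\sum_{I\in\mathcal J_w}t^{|I|},\quad J_w^+(t)=\sum_{I\in\mathcal J_w,\ l+1\in I}t^{|I|},\quad J_w^-(t)=\sum_{I\in\mathcal J_w,\ l+1\notin I}t^{|I|}.$$ *)

theory Defs
  imports
    Main
    "HOL-Library.FuncSet"
    "HOL-Computational_Algebra.Polynomial"
    "HOL-Computational_Algebra.Polynomial_Factorial"
    "HOL-Computational_Algebra.Fraction_Field"
    "Jordan_Normal_Form.Matrix"
begin

subsection \<open>Maximal parabolics of the special linear Lie algebra and their addresses\<close>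

text \<open>Matrix indices start at 0, so the block of rows \<open>i > a\<close> and columns \<open>j \<le> a\<close> in the usual
  numbering is \<open>a \<le> i\<close>, \<open>j < a\<close> here.\<close>

definition maximal_parabolic :: "nat \<Rightarrow> nat \<Rightarrow> 'k::field mat set" where
  "maximal_parabolic a b =
     {X \<in> carrier_mat (a + b) (a + b).
        (\<Sum>i<a + b. X $$ (i, i)) = 0 \<and>
        (\<forall>i j. a \<le> i \<longrightarrow> i < a + b \<longrightarrow> j < a \<longrightarrow> X $$ (i, j) = 0)}"

datatype lr = L | R

fun successor_pair :: "nat \<times> nat \<Rightarrow> lr \<Rightarrow> nat \<times> nat" where
  "successor_pair (a, b) L = (a, a + b)"
| "successor_pair (a, b) R = (a + b, b)"

text \<open>Letters of an address are appended on the right, hence \<^const>\<open>foldl\<close>.\<close>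

definition address_pair :: "lr list \<Rightarrow> nat \<times> nat" where
  "address_pair w = foldl successor_pair (1, 1) w"

definition addressed_parabolic :: "lr list \<Rightarrow> 'k::field mat set" where
  "addressed_parabolic w = (case address_pair w of (a, b) \<Rightarrow> maximal_parabolic a b)"

subsection \<open>Ranked meanders\<close>

definition meander_edges :: "nat \<Rightarrow> nat \<Rightarrow> (nat \<times> nat) set" where
  "meander_edges a b =
     {(i, a + b + 1 - i) | i. 1 \<le> i \<and> i < a + b + 1 - i} \<union>
     {(a + 1 - i, i) | i. 1 \<le> i \<and> i < a + 1 - i} \<union>
     {(a + b + 1 - i, a + i) | i. 1 \<le> i \<and> a + i < a + b + 1 - i}"

definition is_meander_rank :: "nat \<Rightarrow> nat \<Rightarrow> (nat \<Rightarrow> int) \<Rightarrow> bool" where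
  "is_meander_rank a b r \<longleftrightarrow>
     Min (r ` {1..a + b}) = 0 \<and> (\<forall>(k, l) \<in> meander_edges a b. r k = r l + 1)"

text \<open>Extensionality pins down the values off the vertex set, so that the description is unique.\<close>

definition meander_rank :: "nat \<Rightarrow> nat \<Rightarrow> nat \<Rightarrow> int" where
  "meander_rank a b = (THE r. r \<in> extensional {1..a + b} \<and> is_meander_rank a b r)"

definition R_plus :: "lr list \<Rightarrow> int poly" where
  "R_plus w = (case address_pair w of (a, b) \<Rightarrow>
     (\<Sum>i = 1..a. monom 1 (nat (meander_rank a b i))))"

definition R_minus :: "lr list \<Rightarrow> int poly" where
  "R_minus w = (case address_pair w of (a, b) \<Rightarrow>
     (\<Sum>i = a + 1..a + b. monom 1 (nat (meander_rank a b i))))"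

definition R_total :: "lr list \<Rightarrow> int poly" where
  "R_total w = R_plus w + R_minus w"

subsection \<open>Fence posets\<close>

datatype ud = U | D

text \<open>\<open>(x, y) \<in> fence_le w\<close> means \<open>x \<le> y\<close>. The letter \<open>w\<^sub>k\<close> (numbered from 1) is \<open>w ! (k - 1)\<close>.\<close>

definition fence_generators :: "ud list \<Rightarrow> (nat \<times> nat) set" where
  "fence_generators w =
     {(k, k + 1) | k. 1 \<le> k \<and> k \<le> length w \<and> w ! (k - 1) = U} \<union>
     {(k + 1, k) | k. 1 \<le> k \<and> k \<le> length w \<and> w ! (k - 1) = D}"

definition fence_le :: "ud list \<Rightarrow> (nat \<times> nat) set" where
  "fence_le w = (fence_generators w)\<^sup>* \<inter> ({1..length w + 1} \<times> {1..length w + 1})"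

definition fence_ideals :: "ud list \<Rightarrow> nat set set" where
  "fence_ideals w =
     {I. I \<subseteq> {1..length w + 1} \<and> (\<forall>x y. (x, y) \<in> fence_le w \<longrightarrow> y \<in> I \<longrightarrow> x \<in> I)}"

definition J_total :: "ud list \<Rightarrow> int poly" where
  "J_total w = (\<Sum>I \<in> fence_ideals w. monom 1 (card I))"

definition J_plus :: "ud list \<Rightarrow> int poly" where
  "J_plus w = (\<Sum>I \<in> {I \<in> fence_ideals w. length w + 1 \<in> I}. monom 1 (card I))"

definition J_minus :: "ud list \<Rightarrow> int poly" where
  "J_minus w = (\<Sum>I \<in> {I \<in> fence_ideals w. length w + 1 \<notin> I}. monom 1 (card I))"

fun lr_to_ud :: "lr \<Rightarrow> ud" where
  "lr_to_ud L = U"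
| "lr_to_ud R = D"

subsection \<open>Rational functions\<close>

text \<open>The field of rational functions in one variable is \<^typ>\<open>int poly fract\<close>, the fraction field
  of the integer polynomials, which is the same as that of the rational polynomials.\<close>

definition nonneg_polys :: "int poly set" where
  "nonneg_polys = {p. \<forall>i. 0 \<le> coeff p i}"

abbreviation indet :: "int poly" where
  "indet \<equiv> [:0, 1:]"

definition R_bar :: "lr list \<Rightarrow> int poly fract" where
  "R_bar w = Fract (R_plus w) (R_minus w)"

text \<open>Since \<^term>\<open>Fract p 0 = 0\<close> by convention, the rules include that their denominators
  \<open>p + q\<close> are nonzero; the denominator \<open>q\<close> is nonzero by assumption.\<close>

definition successor_family :: "(lr list \<Rightarrow> int poly fract) \<Rightarrow> bool" where
  "successor_family f \<longleftrightarrow>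
     f [] = Fract indet 1 \<and>
     (\<forall>w p q. q \<noteq> 0 \<longrightarrow> f w = Fract p q \<longrightarrow>
        p + q \<noteq> 0 \<and>
        f (w @ [L]) = Fract (indet * p) (p + q) \<and>
        f (w @ [R]) = Fract (indet * (p + q)) q)"

text \<open>\<open>has_value_at f x y\<close>: the rational function \<open>f\<close> is regular at \<open>x\<close> and \<open>f(x) = y\<close>.\<close>

definition has_value_at :: "int poly fract \<Rightarrow> rat \<Rightarrow> rat \<Rightarrow> bool" where
  "has_value_at f x y \<longleftrightarrow>
     (\<exists>p q. f = Fract p q \<and> poly (map_poly rat_of_int q) x \<noteq> 0 \<and>
        y = poly (map_poly rat_of_int p) x / poly (map_poly rat_of_int q) x)"

end

theory Submission
  imports Defs
begin

text \<open>A rank function of the meander of \<open>(a, b)\<close> extends to the meanders of \<open>(a, a + b)\<close> and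
  \<open>(a + b, b)\<close>: in the first case reflection carries the old vertices onto the right block and each
  vertex of the left block lies one step above its image in the right block; in the second case the
  reflected old vertices, raised by one, form the left block. This gives the successor rules
  \<open>(p, q) \<mapsto> (tp, p + q)\<close> and \<open>(p, q) \<mapsto> (t(p + q), q)\<close> for the rank polynomials. Splitting the
  ideals of a fence by whether they contain its last element gives the same rules for the ideal
  polynomials. Both rules preserve the constant terms \<open>p(0) = 0\<close> and \<open>q(0) = 1\<close>, so that \<open>t\<close> is
  coprime to \<open>q\<close> and to \<open>p + q\<close>, and coprimality propagates.\<close>

subsection \<open>Addresses\<close>

lemma address_pair_Nil [simp]: "address_pair [] = (1, 1)"
  by (simp add: address_pair_def)

lemma address_pair_snoc [simp]: "address_pair (w @ [x]) = successor_pair (address_pair w) x"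
  by (simp add: address_pair_def)

lemma address_pair_pos_coprime:
  "address_pair w = (a, b) \<Longrightarrow> 0 < a \<and> 0 < b \<and> coprime a b"
proof (induction w arbitrary: a b rule: rev_induct)
  case (snoc x w)
  obtain c d where cd: "address_pair w = (c, d)" by fastforce
  with snoc.IH have "0 < c" "0 < d" "coprime c d" by auto
  then have "coprime c (c + d)" "coprime (c + d) d"
    by (simp_all add: coprime_iff_gcd_eq_1)
  with snoc.prems cd \<open>0 < c\<close> \<open>0 < d\<close> show ?case by (cases x) auto
qed auto

section \<open>Block sizes recovered from the parabolic subalgebra\<close>

lemma maximal_parabolic_subset_le:
  assumes "0 < a" "a + b = c + d"
    and sub: "(maximal_parabolic c d :: 'k::field mat set) \<subseteq> maximal_parabolic a b"
  shows "c \<le> a"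
proof (rule ccontr)
  assume "\<not> c \<le> a"
  \<comment> \<open>If \<open>a < c\<close>, the matrix unit at \<open>(a, 0)\<close> respects the
    blocks of \<open>(c, d)\<close> but not those of \<open>(a, b)\<close>; \<open>0 < a\<close>
    keeps it off the diagonal, so its trace is zero.\<close>
  define X :: "'k mat" where
    "X = mat (c + d) (c + d) (\<lambda>(i, j). if i = a \<and> j = 0 then 1 else 0)"
  have "X \<in> maximal_parabolic c d"
    using \<open>\<not> c \<le> a\<close> \<open>0 < a\<close> by (auto simp: maximal_parabolic_def X_def intro!: sum.neutral)
  moreover have "X \<notin> maximal_parabolic a b"
  proof -
    have "X $$ (a, 0) = 1" "a < a + b"
      using assms(2) \<open>\<not> c \<le> a\<close> by (auto simp: X_def)
    then show ?thesis
      using \<open>0 < a\<close> by (force simp: maximal_parabolic_def)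
  qed
  ultimately show False using sub by blast
qed

lemma maximal_parabolic_eq_iff:
  assumes "0 < a" "0 < c"
  shows "(maximal_parabolic a b :: 'k::field mat set) = maximal_parabolic c d \<longleftrightarrow> a = c \<and> b = d"
proof
  assume eq: "(maximal_parabolic a b :: 'k mat set) = maximal_parabolic c d"
  \<comment> \<open>The zero matrix lies in both sets, so the sizes \<open>a + b\<close> and
    \<open>c + d\<close> agree.\<close>
  have "(0\<^sub>m (a + b) (a + b) :: 'k mat) \<in> maximal_parabolic a b"
    by (auto simp: maximal_parabolic_def)
  then have "(0\<^sub>m (a + b) (a + b) :: 'k mat) \<in> carrier_mat (c + d) (c + d)"
    unfolding eq by (simp add: maximal_parabolic_def)
  then have n: "a + b = c + d" by auto
  then have "c \<le> a" "a \<le> c"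
    using maximal_parabolic_subset_le[where 'k='k] eq assms by (metis order_refl)+
  with n show "a = c \<and> b = d" by simp
qed auto

subsection \<open>Meander ranks\<close>

text \<open>The edge condition alone, without the normalised minimum: this part is easy to move
  between meanders and, for addressed pairs, fixes the values up to a constant.\<close>

definition meander_potential :: "nat \<Rightarrow> nat \<Rightarrow> (nat \<Rightarrow> int) \<Rightarrow> bool" where
  "meander_potential a b r \<longleftrightarrow> (\<forall>(k, l) \<in> meander_edges a b. r k = r l + 1)"

lemma is_meander_rank_iff:
  "is_meander_rank a b r \<longleftrightarrow> Min (r ` {1..a + b}) = 0 \<and> meander_potential a b r"
  by (simp add: is_meander_rank_def meander_potential_def)

text \<open>Each family of arcs belongs to a reflection, so fixing the sum of the two ends replaces
  the truncated subtractions of \<open>meander_edges\<close> by linear conditions.\<close>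

lemma meander_potential_iff:
  "meander_potential a b r \<longleftrightarrow>
     (\<forall>i j. 1 \<le> i \<longrightarrow> i < j \<longrightarrow> i + j = a + b + 1 \<longrightarrow> r i = r j + 1) \<and>
     (\<forall>i j. 1 \<le> i \<longrightarrow> i < j \<longrightarrow> i + j = a + 1 \<longrightarrow> r j = r i + 1) \<and>
     (\<forall>i j. a < i \<longrightarrow> i < j \<longrightarrow> i + j = 2 * a + b + 1 \<longrightarrow> r j = r i + 1)"
  (is "_ \<longleftrightarrow> ?A \<and> ?B \<and> ?C")
proof
  assume pot: "meander_potential a b r"
  have edge: "r k = r l + 1" if "(k, l) \<in> meander_edges a b" for k l
    using pot that by (auto simp: meander_potential_def)
  have ?A
  proof (intro allI impI edge)
    fix i j :: nat assume "1 \<le> i" "i < j" "i + j = a + b + 1"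
    then have "j = a + b + 1 - i" by simp
    with \<open>1 \<le> i\<close> \<open>i < j\<close> show "(i, j) \<in> meander_edges a b"
      unfolding meander_edges_def by blast
  qed
  moreover have ?B
  proof (intro allI impI edge)
    fix i j :: nat assume "1 \<le> i" "i < j" "i + j = a + 1"
    then have "j = a + 1 - i" by simp
    with \<open>1 \<le> i\<close> \<open>i < j\<close> show "(j, i) \<in> meander_edges a b"
      unfolding meander_edges_def by blast
  qed
  moreover have ?C
  proof (intro allI impI edge)
    fix i j :: nat assume "a < i" "i < j" "i + j = 2 * a + b + 1"
    then have "j = a + b + 1 - (i - a)" "i = a + (i - a)" "1 \<le> i - a" by simp_all
    with \<open>i < j\<close> show "(j, i) \<in> meander_edges a b"
      unfolding meander_edges_def by fastforce
  qed
  ultimately show "?A \<and> ?B \<and> ?C" by blast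
next
  assume "?A \<and> ?B \<and> ?C"
  then show "meander_potential a b r"
    by (auto simp: meander_potential_def meander_edges_def)
qed

lemma meander_potential_topD:
  "meander_potential a b r \<Longrightarrow> 1 \<le> i \<Longrightarrow> i < j \<Longrightarrow> i + j = a + b + 1 \<Longrightarrow> r i = r j + 1"
  by (simp add: meander_potential_iff)

lemma meander_potential_leftD:
  "meander_potential a b r \<Longrightarrow> 1 \<le> i \<Longrightarrow> i < j \<Longrightarrow> i + j = a + 1 \<Longrightarrow> r j = r i + 1"
  by (simp add: meander_potential_iff)

lemma meander_potential_rightD:
  "meander_potential a b r \<Longrightarrow> a < i \<Longrightarrow> i < j \<Longrightarrow> i + j = 2 * a + b + 1 \<Longrightarrow> r j = r i + 1"
  by (simp add: meander_potential_iff)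

lemma is_meander_rankD:
  assumes "is_meander_rank a b r" "0 < a + b"
  shows "i \<in> {1..a + b} \<Longrightarrow> 0 \<le> r i" "\<exists>i \<in> {1..a + b}. r i = 0"
proof -
  have fin: "finite (r ` {1..a + b})" "r ` {1..a + b} \<noteq> {}" using assms(2) by auto
  have min: "Min (r ` {1..a + b}) = 0" using assms(1) by (simp add: is_meander_rank_iff)
  show "0 \<le> r i" if "i \<in> {1..a + b}"
    using Min_le[OF fin(1) imageI[OF that]] by (simp only: min)
  show "\<exists>i \<in> {1..a + b}. r i = 0"
    using Min_in[OF fin] unfolding min by force
qed

lemma is_meander_rankI:
  assumes "meander_potential a b r" "\<And>i. i \<in> {1..a + b} \<Longrightarrow> 0 \<le> r i"
    and "k \<in> {1..a + b}" "r k = 0"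
  shows "is_meander_rank a b r"
  unfolding is_meander_rank_iff
proof
  show "Min (r ` {1..a + b}) = 0"
    using assms(2-4) by (intro Min_eqI) (auto intro: rev_image_eqI[of k])
qed fact

text \<open>Every vertex of the left block has an outgoing edge, so the sinks lie in the right block.\<close>

lemma is_meander_rank_zero_right:
  assumes r: "is_meander_rank a b r" and "0 < b"
  shows "\<exists>i \<in> {a + 1..a + b}. r i = 0"
proof -
  have pot: "meander_potential a b r" using r by (simp add: is_meander_rank_iff)
  obtain i where i: "i \<in> {1..a + b}" "r i = 0" using is_meander_rankD(2)[OF r] assms(2) by auto
  have "\<not> i \<le> a"
  proof
    assume "i \<le> a"
    show False
    proof (cases "2 * i < a + b + 1")
      case True
      then have "r i = r (a + b + 1 - i) + 1"
        using i by (intro meander_potential_topD[OF pot]) auto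
      moreover have "0 \<le> r (a + b + 1 - i)" using i True by (intro is_meander_rankD(1)[OF r]) auto
      ultimately show False using i by simp
    next
      \<comment> \<open>Now \<open>0 < b\<close> gives \<open>2 * i > a + 1\<close>, so
        \<open>i\<close> is the source of its left arc.\<close>
      case False
      then have "r i = r (a + 1 - i) + 1"
        using i \<open>i \<le> a\<close> \<open>0 < b\<close> by (intro meander_potential_leftD[OF pot]) auto
      moreover have "0 \<le> r (a + 1 - i)" using i \<open>i \<le> a\<close> by (intro is_meander_rankD(1)[OF r]) auto
      ultimately show False using i by simp
    qed
  qed
  with i show ?thesis by (intro bexI[of _ i]) auto
qed

section \<open>Transport of ranks to the successor meanders\<close>

text \<open>The right block \<open>{a + 1..2 * a + b}\<close> is a reflected copy of the old
  meander; a top arc leads from a left vertex \<open>i\<close> to the copy of \<open>i\<close>,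
  hence the value \<open>r i + 1\<close>.\<close>

definition rank_L :: "nat \<Rightarrow> nat \<Rightarrow> (nat \<Rightarrow> int) \<Rightarrow> nat \<Rightarrow> int" where
  "rank_L a b r i = (if i \<le> a then r i + 1 else r (2 * a + b + 1 - i))"

text \<open>The left block is a reflected copy of the old meander; top arcs lead from it to the old
  right block shifted by \<open>b\<close>, which forces the raise by one.\<close>

definition rank_R :: "nat \<Rightarrow> nat \<Rightarrow> (nat \<Rightarrow> int) \<Rightarrow> nat \<Rightarrow> int" where
  "rank_R a b r i = (if i \<le> a + b then r (a + b + 1 - i) + 1 else r (i - b))"

text \<open>New left arcs are old left arcs, new right arcs reflect to old top arcs, and new top
  arcs inside the right block reflect to old right arcs. The other top arcs are the step from a left
  vertex to its copy.\<close>

lemma meander_potential_rank_L: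
  assumes "meander_potential a b r"
  shows "meander_potential a (a + b) (rank_L a b r)"
  unfolding meander_potential_iff
proof (intro conjI allI impI)
  fix i j :: nat
  { assume *: "1 \<le> i" "i < j" "i + j = a + (a + b) + 1"
    then have j: "2 * a + b + 1 - i = j" "2 * a + b + 1 - j = i" "\<not> j \<le> a" by auto
    show "rank_L a b r i = rank_L a b r j + 1"
    proof (cases "i \<le> a")
      case False
      then show ?thesis
        using meander_potential_rightD[OF assms, of i j] * j by (simp add: rank_L_def)
    qed (use j in \<open>simp add: rank_L_def\<close>) }
  { assume *: "1 \<le> i" "i < j" "i + j = a + 1"
    then show "rank_L a b r j = rank_L a b r i + 1"
      using meander_potential_leftD[OF assms, of i j] by (simp add: rank_L_def) }
  { assume *: "a < i" "i < j" "i + j = 2 * a + (a + b) + 1"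
    then show "rank_L a b r j = rank_L a b r i + 1"
      using meander_potential_topD[OF assms, of "2 * a + b + 1 - j" "2 * a + b + 1 - i"]
      by (simp add: rank_L_def) }
qed

text \<open>New left arcs reflect to old top arcs, new right arcs are shifted old right arcs, and
  new top arcs inside the left block reflect to old left arcs. The other top arcs are the step
  between the blocks.\<close>

lemma meander_potential_rank_R:
  assumes "meander_potential a b r"
  shows "meander_potential (a + b) b (rank_R a b r)"
  unfolding meander_potential_iff
proof (intro conjI allI impI)
  fix i j :: nat
  { assume *: "1 \<le> i" "i < j" "i + j = a + b + b + 1"
    show "rank_R a b r i = rank_R a b r j + 1"
    proof (cases "j \<le> a + b")
      case True
      then show ?thesis
        using meander_potential_leftD[OF assms, of "a + b + 1 - j" "a + b + 1 - i"] *
        by (simp add: rank_R_def)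
    next
      case False
      with * have "a + b + 1 - i = j - b" "i \<le> a + b" by auto
      with False show ?thesis by (simp add: rank_R_def)
    qed }
  { assume *: "1 \<le> i" "i < j" "i + j = a + b + 1"
    then have "a + b + 1 - i = j" "a + b + 1 - j = i" by auto
    with * show "rank_R a b r j = rank_R a b r i + 1"
      using meander_potential_topD[OF assms, of i j] by (simp add: rank_R_def) }
  { assume *: "a + b < i" "i < j" "i + j = 2 * (a + b) + b + 1"
    then show "rank_R a b r j = rank_R a b r i + 1"
      using meander_potential_rightD[OF assms, of "i - b" "j - b"] by (simp add: rank_R_def) }
qed

lemma is_meander_rank_rank_L:
  assumes r: "is_meander_rank a b r" and "0 < b"
  shows "is_meander_rank a (a + b) (rank_L a b r)"
proof -
  obtain k where k: "k \<in> {a + 1..a + b}" "r k = 0"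
    using is_meander_rank_zero_right[OF assms] by blast
  have nonneg: "0 \<le> r i" if "i \<in> {1..a + b}" for i
    using is_meander_rankD(1)[OF r] that \<open>0 < b\<close> by simp
  show ?thesis
  \<comment> \<open>The mirror image of \<open>k\<close> lies in the right block, where values are
    not raised.\<close>
  proof (rule is_meander_rankI[of _ _ _ "2 * a + b + 1 - k"])
    show "meander_potential a (a + b) (rank_L a b r)"
      using r by (simp add: is_meander_rank_iff meander_potential_rank_L)
  next
    fix i assume "i \<in> {1..a + (a + b)}"
    then have "i \<le> a \<Longrightarrow> 0 \<le> r i" "\<not> i \<le> a \<Longrightarrow> 0 \<le> r (2 * a + b + 1 - i)"
      by (auto intro!: nonneg simp del: One_nat_def)
    then show "0 \<le> rank_L a b r i" by (simp add: rank_L_def)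
  qed (use k in \<open>auto simp: rank_L_def\<close>)
qed

lemma is_meander_rank_rank_R:
  assumes r: "is_meander_rank a b r" and "0 < b"
  shows "is_meander_rank (a + b) b (rank_R a b r)"
proof -
  obtain k where k: "k \<in> {a + 1..a + b}" "r k = 0"
    using is_meander_rank_zero_right[OF assms] by blast
  have nonneg: "0 \<le> r i" if "i \<in> {1..a + b}" for i
    using is_meander_rankD(1)[OF r] that \<open>0 < b\<close> by simp
  show ?thesis
  \<comment> \<open>The new left block takes only values at least 1, so the zero has to come from
    the old right block, shifted by \<open>b\<close>.\<close>
  proof (rule is_meander_rankI[of _ _ _ "k + b"])
    show "meander_potential (a + b) b (rank_R a b r)"
      using r by (simp add: is_meander_rank_iff meander_potential_rank_R)
  next
    fix i assume "i \<in> {1..a + b + b}"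
    then have "i \<le> a + b \<Longrightarrow> 0 \<le> r (a + b + 1 - i)" "\<not> i \<le> a + b \<Longrightarrow> 0 \<le> r (i - b)"
      by (auto intro!: nonneg simp del: One_nat_def)
    then show "0 \<le> rank_R a b r i" by (simp add: rank_R_def)
  qed (use k in \<open>auto simp: rank_R_def\<close>)
qed

lemma ex_is_meander_rank:
  "address_pair w = (a, b) \<Longrightarrow> \<exists>r. is_meander_rank a b r"
proof (induction w arbitrary: a b rule: rev_induct)
  case Nil
  \<comment> \<open>The meander of \<open>(1, 1)\<close> is the single edge from 1 to 2; the minimum
    is attained at 2.\<close>
  have "is_meander_rank 1 1 (\<lambda>i. if i = 1 then 1 else 0)"
    by (rule is_meander_rankI[of _ _ _ 2]) (auto simp: meander_potential_iff)
  with Nil show ?case by auto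
next
  case (snoc x w)
  obtain c d where cd: "address_pair w = (c, d)" by fastforce
  with snoc.IH obtain r where "is_meander_rank c d r" by blast
  moreover have "0 < d" using address_pair_pos_coprime[OF cd] by simp
  ultimately show ?case
    using snoc.prems cd is_meander_rank_rank_L is_meander_rank_rank_R by (cases x) fastforce+
qed

section \<open>Uniqueness of meander ranks\<close>

text \<open>Undoes \<open>rank_L\<close> by reading the old meander off the reflected right block,
  so that uniqueness can descend along the address.\<close>

lemma meander_potential_from_L:
  assumes "meander_potential a (a + b) r"
  shows "meander_potential a b (\<lambda>i. r (2 * a + b + 1 - i))"
  unfolding meander_potential_iff
proof (intro conjI allI impI)
  fix i j :: nat
  { assume "1 \<le> i" "i < j" "i + j = a + b + 1"
    then show "r (2 * a + b + 1 - i) = r (2 * a + b + 1 - j) + 1"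
      by (intro meander_potential_rightD[OF assms]) auto }
  { assume *: "1 \<le> i" "i < j" "i + j = a + 1"
    \<comment> \<open>Top arcs carry both ends to the right block and lower each value by one, so
      the difference is kept.\<close>
    have "r i = r (2 * a + b + 1 - i) + 1" "r j = r (2 * a + b + 1 - j) + 1"
      by (rule meander_potential_topD[OF assms]; use * in simp)+
    moreover have "r j = r i + 1" by (rule meander_potential_leftD[OF assms *])
    ultimately show "r (2 * a + b + 1 - j) = r (2 * a + b + 1 - i) + 1" by simp }
  { assume *: "a < i" "i < j" "i + j = 2 * a + b + 1"
    then have "2 * a + b + 1 - i = j" "2 * a + b + 1 - j = i" by auto
    with * show "r (2 * a + b + 1 - j) = r (2 * a + b + 1 - i) + 1"
      using meander_potential_topD[OF assms, of i j] by simp }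
qed

text \<open>The counterpart for \<open>rank_R\<close>, read off the left block; the raise by one
  there does not affect a potential.\<close>

lemma meander_potential_from_R:
  assumes "meander_potential (a + b) b r"
  shows "meander_potential a b (\<lambda>i. r (a + b + 1 - i))"
  unfolding meander_potential_iff
proof (intro conjI allI impI)
  fix i j :: nat
  { assume *: "1 \<le> i" "i < j" "i + j = a + b + 1"
    then have "a + b + 1 - i = j" "a + b + 1 - j = i" by auto
    with * show "r (a + b + 1 - i) = r (a + b + 1 - j) + 1"
      using meander_potential_leftD[OF assms, of i j] by simp }
  { assume "1 \<le> i" "i < j" "i + j = a + 1"
    then show "r (a + b + 1 - j) = r (a + b + 1 - i) + 1"
      by (intro meander_potential_topD[OF assms]) auto }
  { assume *: "a < i" "i < j" "i + j = 2 * a + b + 1"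
    \<comment> \<open>Old right arcs survive in the new right block, which top arcs join to the left
      block.\<close>
    have "r (a + b + 1 - i) = r (i + b) + 1" "r (a + b + 1 - j) = r (j + b) + 1"
      by (rule meander_potential_topD[OF assms]; use * in simp)+
    moreover have "r (j + b) = r (i + b) + 1"
      by (rule meander_potential_rightD[OF assms]; use * in simp)
    ultimately show "r (a + b + 1 - j) = r (a + b + 1 - i) + 1" by simp }
qed

text \<open>Stands in for connectedness of the meander. Inductively, two potentials differ by a
  constant on the block holding the copy of the old meander; top arcs spread the same constant to
  the other block.\<close>

lemma meander_potential_unique_up_to_const:
  assumes "address_pair w = (a, b)" "meander_potential a b r" "meander_potential a b s"
  shows "\<exists>c. \<forall>i \<in> {1..a + b}. r i = s i + c"
  using assms
proof (induction w arbitrary: a b r s rule: rev_induct)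
  case Nil
  then have "r 1 = r 2 + 1" "s 1 = s 2 + 1" by (auto intro: meander_potential_topD)
  moreover have "{1..a + b} = {1, 2}" using Nil by auto
  ultimately show ?case by (intro exI[of _ "r 1 - s 1"]) auto
next
  case (snoc x w)
  obtain a' b' where w: "address_pair w = (a', b')" by fastforce
  have pos: "0 < a'" "0 < b'" using address_pair_pos_coprime[OF w] by auto
  show ?case
  proof (cases x)
    case L
    with snoc.prems w have ab: "a = a'" "b = a' + b'" by auto
    have pot: "meander_potential a' (a' + b') r" "meander_potential a' (a' + b') s"
      using snoc.prems ab by auto
    obtain c where c: "r (2 * a' + b' + 1 - i) = s (2 * a' + b' + 1 - i) + c"
      if "i \<in> {1..a' + b'}" for i
      using snoc.IH[OF w pot[THEN meander_potential_from_L]] by blast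
    have right: "r i = s i + c" if "i \<in> {a' + 1..2 * a' + b'}" for i
    proof -
      have "2 * a' + b' + 1 - i \<in> {1..a' + b'}" "2 * a' + b' + 1 - (2 * a' + b' + 1 - i) = i"
        using that by auto
      then show ?thesis using c by metis
    qed
    have "r i = s i + c" if i: "i \<in> {1..a'}" for i
    proof -
      have "r i = r (2 * a' + b' + 1 - i) + 1" "s i = s (2 * a' + b' + 1 - i) + 1"
        by (rule pot[THEN meander_potential_topD]; use i pos in auto)+
      moreover have "2 * a' + b' + 1 - i \<in> {a' + 1..2 * a' + b'}" using i by auto
      ultimately show ?thesis using right by simp
    qed
    with right have "r i = s i + c" if "i \<in> {1..a' + (a' + b')}" for i
      using that by (cases "i \<le> a'") auto
    then show ?thesis unfolding ab by blast
  next
    case R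
    with snoc.prems w have ab: "a = a' + b'" "b = b'" by auto
    have pot: "meander_potential (a' + b') b' r" "meander_potential (a' + b') b' s"
      using snoc.prems ab by auto
    obtain c where c: "r (a' + b' + 1 - i) = s (a' + b' + 1 - i) + c"
      if "i \<in> {1..a' + b'}" for i
      using snoc.IH[OF w pot[THEN meander_potential_from_R]] by blast
    have left: "r i = s i + c" if "i \<in> {1..a' + b'}" for i
    proof -
      have "a' + b' + 1 - i \<in> {1..a' + b'}" "a' + b' + 1 - (a' + b' + 1 - i) = i"
        using that by auto
      then show ?thesis using c by metis
    qed
    have "r i = s i + c" if i: "i \<in> {a' + b' + 1..a' + b' + b'}" for i
    proof -
      have "r (a' + b' + b' + 1 - i) = r i + 1" "s (a' + b' + b' + 1 - i) = s i + 1"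
        by (rule pot[THEN meander_potential_topD]; use i pos in auto)+
      moreover have "a' + b' + b' + 1 - i \<in> {1..a' + b'}" using i by auto
      ultimately show ?thesis using left by force
    qed
    with left have "r i = s i + c" if "i \<in> {1..a' + b' + b'}" for i
      using that by (cases "i \<le> a' + b'") auto
    then show ?thesis unfolding ab by blast
  qed
qed

text \<open>With \<open>r = s + c\<close> and all ranks nonnegative, a zero of \<open>r\<close>
  gives \<open>c \<le> 0\<close> and a zero of \<open>s\<close> gives
  \<open>c \<ge> 0\<close>.\<close>

lemma is_meander_rank_unique:
  assumes w: "address_pair w = (a, b)" and r: "is_meander_rank a b r" and s: "is_meander_rank a b s"
    and i: "i \<in> {1..a + b}"
  shows "r i = s i"
proof -
  have pos: "0 < a + b" using address_pair_pos_coprime[OF w] by simp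
  obtain c where c: "\<forall>i \<in> {1..a + b}. r i = s i + c"
    using meander_potential_unique_up_to_const[OF w] r s unfolding is_meander_rank_iff by blast
  obtain k l where "k \<in> {1..a + b}" "r k = 0" "l \<in> {1..a + b}" "s l = 0"
    using is_meander_rankD(2)[OF r pos] is_meander_rankD(2)[OF s pos] by blast
  moreover from this have "0 \<le> s k" "0 \<le> r l"
    using is_meander_rankD(1)[OF r pos] is_meander_rankD(1)[OF s pos] by blast+
  ultimately have "c = 0" using c by force
  with c i show ?thesis by simp
qed

text \<open>Lets any explicit rank function replace the definite description; restricting it to the
  vertices supplies extensionality.\<close>

lemma meander_rank_eq:
  assumes w: "address_pair w = (a, b)" and r: "is_meander_rank a b r" and i: "i \<in> {1..a + b}"
  shows "meander_rank a b i = r i"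
proof -
  have img: "restrict r {1..a + b} ` {1..a + b} = r ` {1..a + b}" by auto
  have "meander_potential a b (restrict r {1..a + b})"
    using r by (auto simp: is_meander_rank_iff meander_potential_iff)
  then have "is_meander_rank a b (restrict r {1..a + b})"
    using r img by (simp add: is_meander_rank_iff)
  then have "meander_rank a b = restrict r {1..a + b}"
    unfolding meander_rank_def
    by (intro the_equality) (auto intro!: extensionalityI[of _ "{1..a + b}"] is_meander_rank_unique[OF w])
  with i show ?thesis by simp
qed

section \<open>Rank polynomials and their successor rules\<close>

lemma R_plus_eq:
  assumes "address_pair w = (a, b)" "is_meander_rank a b r"
  shows "R_plus w = (\<Sum>i = 1..a. monom 1 (nat (r i)))"
  using assms by (simp add: R_plus_def meander_rank_eq)

lemma R_minus_eq:
  assumes "address_pair w = (a, b)" "is_meander_rank a b r"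
  shows "R_minus w = (\<Sum>i = a + 1..a + b. monom 1 (nat (r i)))"
  using assms by (simp add: R_minus_def meander_rank_eq)

lemma R_total_eq:
  assumes "address_pair w = (a, b)" "is_meander_rank a b r"
  shows "R_total w = (\<Sum>i = 1..a + b. monom 1 (nat (r i)))"
  unfolding R_total_def R_plus_eq[OF assms] R_minus_eq[OF assms]
  by (subst sum.ub_add_nat) auto

lemma indet_mult_monom: "indet * monom c n = monom c (Suc n)"
  by (simp add: monom_Suc)

lemma R_Nil: "R_plus [] = indet" "R_minus [] = 1"
proof -
  have r: "is_meander_rank 1 1 (\<lambda>i. if i = 1 then 1 else 0)"
    by (rule is_meander_rankI[of _ _ _ 2]) (auto simp: meander_potential_iff)
  show "R_plus [] = indet" "R_minus [] = 1"
    using R_plus_eq[OF _ r, of "[]"] R_minus_eq[OF _ r, of "[]"]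
    by (simp_all add: monom_Suc one_pCons)
qed

lemma R_snoc_L: "R_plus (w @ [L]) = indet * R_plus w" "R_minus (w @ [L]) = R_total w"
proof -
  obtain a b where w: "address_pair w = (a, b)" by fastforce
  obtain r where r: "is_meander_rank a b r" using ex_is_meander_rank[OF w] by blast
  have pos: "0 < b" using address_pair_pos_coprime[OF w] by simp
  note w' = address_pair_snoc[of w L, unfolded w successor_pair.simps]
  note r' = is_meander_rank_rank_L[OF r pos]
  \<comment> \<open>Nonnegativity gives \<open>nat (r i + 1) = Suc (nat (r i))\<close>, which turns
    the raise into the factor \<open>indet\<close>.\<close>
  have nonneg: "0 \<le> r i" if "i \<in> {1..a + b}" for i
    using is_meander_rankD(1)[OF r] that pos by simp
  show "R_plus (w @ [L]) = indet * R_plus w"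
    unfolding R_plus_eq[OF w' r'] R_plus_eq[OF w r] sum_distrib_left indet_mult_monom
  proof (rule sum.cong)
    fix i assume "i \<in> {1..a}"
    then show "monom (1::int) (nat (rank_L a b r i)) = monom 1 (Suc (nat (r i)))"
      using nonneg[of i] by (simp add: rank_L_def Suc_nat_eq_nat_zadd1 add.commute)
  qed simp
  show "R_minus (w @ [L]) = R_total w"
    unfolding R_minus_eq[OF w' r'] R_total_eq[OF w r]
    by (rule sum.reindex_bij_witness[of _ "\<lambda>i. 2 * a + b + 1 - i" "\<lambda>i. 2 * a + b + 1 - i"])
       (auto simp: rank_L_def)
qed

lemma R_snoc_R: "R_plus (w @ [R]) = indet * R_total w" "R_minus (w @ [R]) = R_minus w"
proof -
  obtain a b where w: "address_pair w = (a, b)" by fastforce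
  obtain r where r: "is_meander_rank a b r" using ex_is_meander_rank[OF w] by blast
  have pos: "0 < b" using address_pair_pos_coprime[OF w] by simp
  note w' = address_pair_snoc[of w R, unfolded w successor_pair.simps]
  note r' = is_meander_rank_rank_R[OF r pos]
  have nonneg: "0 \<le> r i" if "i \<in> {1..a + b}" for i
    using is_meander_rankD(1)[OF r] that pos by simp
  show "R_plus (w @ [R]) = indet * R_total w"
    unfolding R_plus_eq[OF w' r'] R_total_eq[OF w r] sum_distrib_left indet_mult_monom
  \<comment> \<open>The reflection is its own inverse and matches the new left block with all old
    vertices.\<close>
  proof (rule sum.reindex_bij_witness[of _ "\<lambda>i. a + b + 1 - i" "\<lambda>i. a + b + 1 - i"])
    fix i assume "i \<in> {1..a + b}"
    moreover from this have "0 \<le> r (a + b + 1 - i)" by (intro nonneg) auto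
    ultimately show "monom (1::int) (Suc (nat (r (a + b + 1 - i)))) = monom 1 (nat (rank_R a b r i))"
      by (simp add: rank_R_def Suc_nat_eq_nat_zadd1 add.commute)
  qed auto
  show "R_minus (w @ [R]) = R_minus w"
    unfolding R_minus_eq[OF w' r'] R_minus_eq[OF w r]
    by (rule sum.reindex_bij_witness[of _ "\<lambda>i. i + b" "\<lambda>i. i - b"]) (auto simp: rank_R_def)
qed

subsection \<open>Fence ideals\<close>

text \<open>Closure under the generators passes to their reflexive transitive closure by induction,
  so ideals can be tested on neighbouring elements.\<close>

lemma fence_ideals_iff:
  "I \<in> fence_ideals w \<longleftrightarrow>
     I \<subseteq> {1..length w + 1} \<and> (\<forall>(x, y) \<in> fence_generators w. y \<in> I \<longrightarrow> x \<in> I)"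
proof
  assume I: "I \<in> fence_ideals w"
  have "fence_generators w \<subseteq> fence_le w"
    by (auto simp: fence_le_def fence_generators_def)
  with I show "I \<subseteq> {1..length w + 1} \<and> (\<forall>(x, y) \<in> fence_generators w. y \<in> I \<longrightarrow> x \<in> I)"
    unfolding fence_ideals_def by blast
next
  assume *: "I \<subseteq> {1..length w + 1} \<and> (\<forall>(x, y) \<in> fence_generators w. y \<in> I \<longrightarrow> x \<in> I)"
  have "y \<in> I \<longrightarrow> x \<in> I" if "(x, y) \<in> (fence_generators w)\<^sup>*" for x y
    using that by (induction rule: rtrancl_induct) (use * in auto)
  with * show "I \<in> fence_ideals w" by (auto simp: fence_ideals_def fence_le_def)
qed

lemma fence_ideals_subset: "I \<in> fence_ideals w \<Longrightarrow> I \<subseteq> {1..length w + 1}"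
  by (simp add: fence_ideals_def)

lemma finite_fence_ideals: "finite (fence_ideals w)"
  by (rule finite_subset[of _ "Pow {1..length w + 1}"]) (use fence_ideals_subset in auto)

lemma fence_generators_iff:
  "(x, y) \<in> fence_generators w \<longleftrightarrow>
     1 \<le> x \<and> y = x + 1 \<and> x \<le> length w \<and> w ! (x - 1) = U \<or>
     1 \<le> y \<and> x = y + 1 \<and> y \<le> length w \<and> w ! (y - 1) = D"
  by (auto simp: fence_generators_def)

section \<open>Fences extended by one letter\<close>

lemma fence_generators_snoc_U:
  "fence_generators (w @ [U]) = insert (length w + 1, length w + 2) (fence_generators w)"
proof (rule Set.set_eqI)
  fix e :: "nat \<times> nat"
  obtain x y where e: "e = (x, y)" by fastforce
  \<comment> \<open>In this strict form \<open>less_Suc_eq\<close> separates the last letter from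
    the letters of \<open>w\<close>.\<close>
  have [simp]: "Suc n \<le> Suc m \<longleftrightarrow> n < Suc m" for n m by auto
  show "e \<in> fence_generators (w @ [U]) \<longleftrightarrow> e \<in> insert (length w + 1, length w + 2) (fence_generators w)"
    unfolding e insert_iff fence_generators_iff
    by (cases x; cases y) (auto simp: nth_append less_Suc_eq)
qed

lemma fence_generators_snoc_D:
  "fence_generators (w @ [D]) = insert (length w + 2, length w + 1) (fence_generators w)"
proof (rule Set.set_eqI)
  fix e :: "nat \<times> nat"
  obtain x y where e: "e = (x, y)" by fastforce
  have [simp]: "Suc n \<le> Suc m \<longleftrightarrow> n < Suc m" for n m by auto
  show "e \<in> fence_generators (w @ [D]) \<longleftrightarrow> e \<in> insert (length w + 2, length w + 1) (fence_generators w)"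
    unfolding e insert_iff fence_generators_iff
    by (cases x; cases y) (auto simp: nth_append less_Suc_eq)
qed

lemma fence_generators_subset:
  "fence_generators w \<subseteq> {1..length w + 1} \<times> {1..length w + 1}"
  by (auto simp: fence_generators_def)

text \<open>The old generators remain and none of them touches \<open>length w + 2\<close>, so
  dropping that element preserves closure.\<close>

lemma fence_ideals_snoc_restrict:
  assumes "I \<in> fence_ideals (w @ [x])"
  shows "I - {length w + 2} \<in> fence_ideals w"
proof -
  have "fence_generators w \<subseteq> fence_generators (w @ [x])"
    by (cases x) (auto simp: fence_generators_snoc_U fence_generators_snoc_D)
  then show ?thesis
    using assms fence_generators_subset[of w] unfolding fence_ideals_iff by force
qed

text \<open>The one new relation compares \<open>length w + 1\<close> with
  \<open>length w + 2\<close>: after \<open>U\<close> the new element requires its neighbour, after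
  \<open>D\<close> the neighbour requires the new element.\<close>

lemma fence_ideals_snoc_extend_iff:
  assumes "I \<in> fence_ideals w"
  shows "I \<in> fence_ideals (w @ [U])"
    and "insert (length w + 2) I \<in> fence_ideals (w @ [D])"
    and "insert (length w + 2) I \<in> fence_ideals (w @ [U]) \<longleftrightarrow> length w + 1 \<in> I"
    and "I \<in> fence_ideals (w @ [D]) \<longleftrightarrow> length w + 1 \<notin> I"
  using assms fence_generators_subset[of w]
  unfolding fence_ideals_iff fence_generators_snoc_U fence_generators_snoc_D by force+

lemma fence_ideals_snoc_U_plus:
  "{I \<in> fence_ideals (w @ [U]). length w + 2 \<in> I} =
     insert (length w + 2) ` {I \<in> fence_ideals w. length w + 1 \<in> I}" (is "?A = ?B")
proof (intro equalityI subsetI)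
  fix I assume I: "I \<in> ?A"
  define J where "J = I - {length w + 2}"
  have IJ: "I = insert (length w + 2) J" using I by (auto simp: J_def)
  have J: "J \<in> fence_ideals w" using I fence_ideals_snoc_restrict[of I w U] by (simp add: J_def)
  show "I \<in> ?B"
    using I fence_ideals_snoc_extend_iff(3)[OF J] J unfolding IJ by blast
qed (use fence_ideals_snoc_extend_iff in blast)

lemma fence_ideals_snoc_U_minus:
  "{I \<in> fence_ideals (w @ [U]). length w + 2 \<notin> I} = fence_ideals w"
proof (intro equalityI subsetI)
  fix I assume "I \<in> {I \<in> fence_ideals (w @ [U]). length w + 2 \<notin> I}"
  then show "I \<in> fence_ideals w" using fence_ideals_snoc_restrict[of I w U] by simp
next
  fix I assume "I \<in> fence_ideals w"
  then show "I \<in> {I \<in> fence_ideals (w @ [U]). length w + 2 \<notin> I}"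
    using fence_ideals_snoc_extend_iff(1)[of I w] fence_ideals_subset[of I w] by auto
qed

lemma fence_ideals_snoc_D_plus:
  "{I \<in> fence_ideals (w @ [D]). length w + 2 \<in> I} = insert (length w + 2) ` fence_ideals w"
  (is "?A = ?B")
proof (intro equalityI subsetI)
  fix I assume I: "I \<in> ?A"
  then have "insert (length w + 2) (I - {length w + 2}) = I" by auto
  moreover have "I - {length w + 2} \<in> fence_ideals w"
    using I fence_ideals_snoc_restrict[of I w D] by simp
  ultimately show "I \<in> ?B" by (metis imageI)
qed (use fence_ideals_snoc_extend_iff in blast)

lemma fence_ideals_snoc_D_minus:
  "{I \<in> fence_ideals (w @ [D]). length w + 2 \<notin> I} = {I \<in> fence_ideals w. length w + 1 \<notin> I}"
proof (intro equalityI subsetI)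
  fix I assume I: "I \<in> {I \<in> fence_ideals (w @ [D]). length w + 2 \<notin> I}"
  then have "I \<in> fence_ideals w" using fence_ideals_snoc_restrict[of I w D] by simp
  with I show "I \<in> {I \<in> fence_ideals w. length w + 1 \<notin> I}"
    using fence_ideals_snoc_extend_iff(4)[of I w] by blast
next
  fix I assume "I \<in> {I \<in> fence_ideals w. length w + 1 \<notin> I}"
  then show "I \<in> {I \<in> fence_ideals (w @ [D]). length w + 2 \<notin> I}"
    using fence_ideals_snoc_extend_iff(4)[of I w] fence_ideals_subset[of I w] by auto
qed

text \<open>Ideals of \<open>w\<close> never contain \<open>length w + 2\<close>, so the insertion
  is injective and raises every cardinality by one.\<close>

lemma sum_monom_card_insert:
  assumes "A \<subseteq> fence_ideals w"
  shows "(\<Sum>I \<in> insert (length w + 2) ` A. monom 1 (card I)) = indet * (\<Sum>I \<in> A. monom 1 (card I))"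
proof -
  have sub: "I \<subseteq> {1..length w + 1}" if "I \<in> A" for I
    using that assms fence_ideals_subset by blast
  have notin: "length w + 2 \<notin> I" if "I \<in> A" for I
    using sub[OF that] by force
  have fin: "finite I" if "I \<in> A" for I
    using sub[OF that] finite_atLeastAtMost by (rule finite_subset)
  have inj: "inj_on (insert (length w + 2)) A"
    by (rule inj_onI) (metis insert_ident notin)
  have card: "card (insert (length w + 2) I) = Suc (card I)" if "I \<in> A" for I
    using notin[OF that] fin[OF that] by (rule card_insert_disjoint[rotated])
  show ?thesis
    unfolding sum.reindex[OF inj] sum_distrib_left indet_mult_monom
    by (rule sum.cong) (simp_all only: o_def card)
qed

lemma J_total_eq: "J_total w = J_plus w + J_minus w"
  unfolding J_total_def J_plus_def J_minus_def
  by (subst sum.union_disjoint[symmetric]) (auto simp: finite_fence_ideals intro!: sum.cong)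

lemma J_snoc_U: "J_plus (w @ [U]) = indet * J_plus w" "J_minus (w @ [U]) = J_total w"
proof -
  have len: "length (w @ [U]) + 1 = length w + 2" by simp
  show "J_plus (w @ [U]) = indet * J_plus w"
    unfolding J_plus_def J_total_def len fence_ideals_snoc_U_plus
    by (rule sum_monom_card_insert) auto
  show "J_minus (w @ [U]) = J_total w"
    unfolding J_minus_def J_total_def len fence_ideals_snoc_U_minus ..
qed

lemma J_snoc_D: "J_plus (w @ [D]) = indet * J_total w" "J_minus (w @ [D]) = J_minus w"
proof -
  have len: "length (w @ [D]) + 1 = length w + 2" by simp
  show "J_plus (w @ [D]) = indet * J_total w"
    unfolding J_plus_def J_total_def len fence_ideals_snoc_D_plus
    by (rule sum_monom_card_insert) auto
  show "J_minus (w @ [D]) = J_minus w"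
    unfolding J_minus_def J_total_def len fence_ideals_snoc_D_minus ..
qed

lemma J_Nil: "J_plus [] = indet" "J_minus [] = 1"
proof -
  have "fence_ideals [] = {{}, {1}}"
    by (auto simp: fence_ideals_iff fence_generators_def)
  then have "{I \<in> fence_ideals []. length [] + 1 \<in> I} = {{1}}"
    "{I \<in> fence_ideals []. length [] + 1 \<notin> I} = {{}}" by auto
  then show "J_plus [] = indet" "J_minus [] = 1"
    unfolding J_plus_def J_minus_def by (simp_all add: monom_Suc one_pCons)
qed

text \<open>Both pairs start at \<open>(indet, 1)\<close> and obey the same recursion; no bijection
  between vertices and ideals is constructed.\<close>

lemma R_eq_J:
  "R_plus w = J_plus (map lr_to_ud w) \<and> R_minus w = J_minus (map lr_to_ud w)"
proof (induction w rule: rev_induct)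
  case (snoc x w)
  then show ?case
    \<comment> \<open>Products with \<open>indet\<close> stay unexpanded, so that both recursions
      match literally.\<close>
    by (cases x) (simp_all add: R_snoc_L R_snoc_R J_snoc_U J_snoc_D R_total_def J_total_eq
        del: mult_pCons_left)
qed (simp add: R_Nil J_Nil)

subsection \<open>Rational functions\<close>

lemma nonneg_polys_sum_monom: "(\<Sum>i \<in> A. monom 1 (f i)) \<in> nonneg_polys"
  by (auto simp: nonneg_polys_def coeff_sum intro!: sum_nonneg)

lemma R_nonneg: "R_plus w \<in> nonneg_polys" "R_minus w \<in> nonneg_polys" "R_total w \<in> nonneg_polys"
proof -
  show "R_plus w \<in> nonneg_polys" "R_minus w \<in> nonneg_polys"
    by (auto simp: R_plus_def R_minus_def nonneg_polys_sum_monom split: prod.split)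
  then show "R_total w \<in> nonneg_polys" by (simp add: R_total_def nonneg_polys_def)
qed

section \<open>Coprimality\<close>

text \<open>Writing \<open>q = 1 + indet * s\<close>, a common divisor of \<open>indet\<close> and
  \<open>q\<close> divides 1.\<close>

lemma coprime_indet:
  fixes q :: "int poly"
  assumes "coeff q 0 = 1"
  shows "coprime indet q"
proof (cases q)
  case (pCons c s)
  then have "q = 1 + indet * s" using assms by (simp add: one_pCons)
  then show ?thesis by (metis coprime_1_right coprime_iff_gcd_eq_1 gcd_add_mult mult.commute add.commute)
qed

text \<open>These constant terms serve twice: for coprimality with \<open>indet\<close> and for
  nonzero denominators.\<close>

lemma R_coeff_0: "coeff (R_plus w) 0 = 0 \<and> coeff (R_minus w) 0 = 1"
proof (induction w rule: rev_induct)
  case (snoc x w)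
  then show ?case by (cases x) (simp_all add: R_snoc_L R_snoc_R R_total_def)
qed (simp add: R_Nil)

lemma R_minus_nonzero: "R_minus w \<noteq> 0" and R_total_nonzero: "R_total w \<noteq> 0"
proof -
  have "coeff (R_minus w) 0 = 1" "coeff (R_total w) 0 = 1"
    using R_coeff_0[of w] by (simp_all add: R_total_def)
  then show "R_minus w \<noteq> 0" "R_total w \<noteq> 0" by auto
qed

lemma coprime_R: "coprime (R_plus w) (R_minus w)"
proof (induction w rule: rev_induct)
  case (snoc x w)
  have t: "coprime indet (R_total w)" "coprime indet (R_minus w)"
    using R_coeff_0[of w] by (auto intro!: coprime_indet simp: R_total_def)
  \<comment> \<open>A common divisor of \<open>R_total w\<close> and one of its two summands divides
    the other summand.\<close>
  have "coprime (R_plus w) (R_total w)" "coprime (R_total w) (R_minus w)"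
    using snoc by (auto simp: R_total_def coprime_def dvd_add_right_iff dvd_add_left_iff)
  with t show ?case
    by (cases x) (simp_all add: R_snoc_L R_snoc_R del: mult_pCons_left)
qed (simp add: R_Nil)

section \<open>The successor family\<close>

text \<open>The rules must hold for every representation \<open>p / q\<close> of
  \<open>R_bar w\<close>, not just the reduced one; all claims come from cross-multiplied
  identities.\<close>

lemma successor_family_R_bar: "successor_family R_bar"
  unfolding successor_family_def
proof (intro conjI allI impI)
  show "R_bar [] = Fract indet 1" by (simp add: R_bar_def R_Nil)
next
  fix w p q
  assume q: "q \<noteq> 0" and "R_bar w = Fract p q"
  then have cross: "R_plus w * q = p * R_minus w"
    by (simp add: R_bar_def eq_fract R_minus_nonzero)
  have tot: "R_total w * q = (p + q) * R_minus w"
    using cross by (simp add: R_total_def algebra_simps)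
  \<comment> \<open>The left side of \<open>tot\<close> is a product of nonzero polynomials, so the
    factor \<open>p + q\<close> on the right is nonzero.\<close>
  show pq: "p + q \<noteq> 0"
    using tot q R_total_nonzero[of w] by auto
  have "R_plus w * (p + q) = p * R_total w"
    using cross by (simp add: R_total_def algebra_simps)
  then show "R_bar (w @ [L]) = Fract (indet * p) (p + q)"
    unfolding R_bar_def R_snoc_L using pq R_total_nonzero[of w]
    by (simp add: eq_fract mult.assoc del: mult_pCons_left)
  show "R_bar (w @ [R]) = Fract (indet * (p + q)) q"
    unfolding R_bar_def R_snoc_R using tot q R_minus_nonzero[of w]
    by (simp add: eq_fract mult.assoc del: mult_pCons_left)
qed

text \<open>Applying the rules to the representation \<open>R_plus w / R_minus w\<close> determines
  both successors.\<close>

lemma successor_family_unique: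
  assumes "successor_family f"
  shows "f = R_bar"
proof
  fix w show "f w = R_bar w"
  proof (induction w rule: rev_induct)
    case Nil
    then show ?case using assms by (simp add: successor_family_def R_bar_def R_Nil)
  next
    case (snoc x w)
    then have "f w = Fract (R_plus w) (R_minus w)" by (simp add: R_bar_def)
    then have "f (w @ [L]) = R_bar (w @ [L])" "f (w @ [R]) = R_bar (w @ [R])"
      using assms R_minus_nonzero[of w]
      unfolding successor_family_def R_bar_def R_snoc_L R_snoc_R R_total_def by blast+
    then show ?case by (cases x) auto
  qed
qed

section \<open>Specialization at \<open>t = 1\<close>\<close>

lemma poly_R_1:
  "address_pair w = (a, b) \<Longrightarrow> poly (R_plus w) 1 = int a \<and> poly (R_minus w) 1 = int b"
  by (auto simp: R_plus_def R_minus_def poly_sum poly_monom)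

lemma poly_map_rat_of_int_1: "poly (map_poly rat_of_int p) 1 = rat_of_int (poly p 1)"
  by (induction p) (simp_all add: map_poly_pCons)

text \<open>\<open>has_value_at\<close> only asks for some representation regular at 1; comparing it
  with \<open>R_plus w / R_minus w\<close> shows that the value does not depend on the
  choice.\<close>

lemma has_value_at_R_bar_iff:
  assumes w: "address_pair w = (a, b)"
  shows "has_value_at (R_bar w) 1 y \<longleftrightarrow> y = of_nat a / of_nat b"
proof -
  have b: "0 < b" using address_pair_pos_coprime[OF w] by simp
  note val = poly_R_1[OF w]
  show ?thesis
  proof
    assume "has_value_at (R_bar w) 1 y"
    then obtain p q where f: "R_bar w = Fract p q" and q: "poly q 1 \<noteq> 0"
      and y: "y = rat_of_int (poly p 1) / rat_of_int (poly q 1)"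
      unfolding has_value_at_def poly_map_rat_of_int_1 by auto
    \<comment> \<open>This excludes the default value of \<open>Fract p 0\<close>, so equality of
      fractions means cross multiplication.\<close>
    have "q \<noteq> 0" using q by auto
    then have "R_plus w * q = p * R_minus w"
      using f by (simp add: R_bar_def eq_fract R_minus_nonzero)
    then have "int a * poly q 1 = poly p 1 * int b"
      using val by (metis poly_mult)
    then have "rat_of_nat a * rat_of_int (poly q 1) = rat_of_int (poly p 1) * rat_of_nat b"
      by (metis of_int_mult of_int_of_nat_eq)
    with q b show "y = of_nat a / of_nat b" unfolding y by (simp add: field_simps)
  next
    assume "y = of_nat a / of_nat b"
    then show "has_value_at (R_bar w) 1 y"
      unfolding has_value_at_def poly_map_rat_of_int_1 R_bar_def
      using val b by (intro exI[of _ "R_plus w"] exI[of _ "R_minus w"]) auto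
  qed
qed

lemma coprime_ratio_eq_iff:
  fixes a b c d :: nat
  assumes "0 < b" "0 < d" "coprime a b" "coprime c d"
  shows "(of_nat a / of_nat b :: rat) = of_nat c / of_nat d \<longleftrightarrow> a = c \<and> b = d"
proof
  assume "(of_nat a / of_nat b :: rat) = of_nat c / of_nat d"
  then have "rat_of_nat (a * d) = rat_of_nat (c * b)"
    using assms by (simp add: field_simps)
  then have eq: "a * d = c * b" by (simp only: of_nat_eq_iff)
  \<comment> \<open>\<open>b\<close> divides \<open>a * d\<close> and is coprime to
    \<open>a\<close>; likewise \<open>d\<close> divides \<open>c * b\<close> and is coprime to
    \<open>c\<close>.\<close>
  then have "b dvd d" "d dvd b"
    using assms by (metis coprime_commute coprime_dvd_mult_right_iff dvd_triv_right)+
  then have "b = d" by (rule dvd_antisym)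
  with eq assms show "a = c \<and> b = d" by simp
qed simp

text \<open>The fraction \<open>a / b\<close> may be unreduced; it equals the ratio of the address
  pair, and both successor ratios depend on that ratio alone.\<close>

lemma has_value_at_snoc:
  assumes "0 < a" "0 < b" "has_value_at (R_bar w) 1 (of_nat a / of_nat b)"
  shows "has_value_at (R_bar (w @ [L])) 1 (of_nat a / of_nat (a + b))"
    and "has_value_at (R_bar (w @ [R])) 1 (of_nat (a + b) / of_nat b)"
proof -
  obtain c d where w: "address_pair w = (c, d)" by fastforce
  have pos: "0 < c" "0 < d" using address_pair_pos_coprime[OF w] by auto
  have eq: "(of_nat a / of_nat b :: rat) = of_nat c / of_nat d"
    using assms(3) has_value_at_R_bar_iff[OF w] by simp
  have "(of_nat a / of_nat (a + b) :: rat) = of_nat c / of_nat (c + d)"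
    using eq pos assms by (simp add: field_simps)
  moreover have "address_pair (w @ [L]) = (c, c + d)" using w by simp
  ultimately show "has_value_at (R_bar (w @ [L])) 1 (of_nat a / of_nat (a + b))"
    using has_value_at_R_bar_iff by blast
  have "(of_nat (a + b) / of_nat b :: rat) = of_nat (c + d) / of_nat d"
    using eq pos assms by (simp add: field_simps)
  moreover have "address_pair (w @ [R]) = (c + d, d)" using w by simp
  ultimately show "has_value_at (R_bar (w @ [R])) 1 (of_nat (a + b) / of_nat b)"
    using has_value_at_R_bar_iff by blast
qed

text \<open>Both sides say that \<open>address_pair w = (a, b)\<close>: reduced positive fractions
  determine their terms, and the algebras determine their block sizes.\<close>

lemma has_value_at_iff_addressed_parabolic:
  assumes "0 < a" "0 < b" "coprime a b"
  shows "has_value_at (R_bar w) 1 (of_nat a / of_nat b) \<longleftrightarrow>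
     (addressed_parabolic w :: 'k::field mat set) = maximal_parabolic a b"
proof -
  obtain c d where w: "address_pair w = (c, d)" by fastforce
  note cd = address_pair_pos_coprime[OF w]
  show ?thesis
    unfolding has_value_at_R_bar_iff[OF w] addressed_parabolic_def w prod.case
    using coprime_ratio_eq_iff[of b d a c] maximal_parabolic_eq_iff[of c a d b, where 'k='k] assms cd
    by auto
qed

theorem proposition5:
  shows
    "(\<forall>w. (R_plus w, R_minus w, R_total w) =
          (J_plus (map lr_to_ud w), J_minus (map lr_to_ud w), J_total (map lr_to_ud w)) \<and>
          {R_plus w, R_minus w, R_total w} \<subseteq> nonneg_polys) \<and>
     (\<forall>w. coprime (R_plus w) (R_minus w)) \<and>
     (\<forall>w. R_minus w \<noteq> 0) \<and>
     successor_family R_bar \<and>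
     (\<forall>f. successor_family f \<longrightarrow> f = R_bar) \<and>
     has_value_at (R_bar []) 1 (1 / 1) \<and>
     (\<forall>w (a::nat) (b::nat). 0 < a \<longrightarrow> 0 < b \<longrightarrow>
          has_value_at (R_bar w) 1 (of_nat a / of_nat b) \<longrightarrow>
          has_value_at (R_bar (w @ [L])) 1 (of_nat a / of_nat (a + b)) \<and>
          has_value_at (R_bar (w @ [R])) 1 (of_nat (a + b) / of_nat b)) \<and>
     (\<forall>w (a::nat) (b::nat). 0 < a \<longrightarrow> 0 < b \<longrightarrow> coprime a b \<longrightarrow>
          (has_value_at (R_bar w) 1 (of_nat a / of_nat b) \<longleftrightarrow>
           (addressed_parabolic w :: 'k::field mat set) = maximal_parabolic a b))"
proof (intro conjI)
  show "\<forall>w. (R_plus w, R_minus w, R_total w) =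
          (J_plus (map lr_to_ud w), J_minus (map lr_to_ud w), J_total (map lr_to_ud w)) \<and>
          {R_plus w, R_minus w, R_total w} \<subseteq> nonneg_polys"
    using R_eq_J R_nonneg by (simp add: R_total_def J_total_eq)
  show "\<forall>w. coprime (R_plus w) (R_minus w)" by (intro allI coprime_R)
  show "\<forall>w. R_minus w \<noteq> 0" by (intro allI R_minus_nonzero)
  show "successor_family R_bar" by (rule successor_family_R_bar)
  show "\<forall>f. successor_family f \<longrightarrow> f = R_bar"
    by (intro allI impI successor_family_unique)
  show "has_value_at (R_bar []) 1 (1 / 1)"
    using has_value_at_R_bar_iff[of "[]" 1 1] by simp
qed (intro allI impI conjI has_value_at_snoc has_value_at_iff_addressed_parabolic; assumption)+

end
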